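(* Let $\alpha:I\to\mathbb{R}^3$ be a nonplanar arclength parametrized curve with curvature $\kappa_\alpha>0$ and torsion $\tau_\alpha$. Then $\alpha$ is a normal helix with $W$ orthogonal to $V$ (that is, there exist a unit $F$-constant normal vector field $W$ along $\alpha$ and a nonzero constant vector $V\in\mathbb{R}^3$ with $\langle W(s),V\rangle=0$ for all $s\in I$) if and only if there is a constant $\theta\in(-\pi/2,\pi/2)$ such that $$\frac{\kappa_\alpha}{\cos^2\theta\,\kappa_\alpha^2+\tau_\alpha^2}\left(\frac{\tau_\alpha}{\kappa_\alpha}\right)'=-\tan\theta$$ on $I$.
   Context: $I$ is an open interval and all curves and functions are smooth ($C^\infty$). For an arclength parametrized curve $\alpha:I\to\mathbb{R}^3$ with $\kappa_\alpha>0$, the Frenet frame $\{T_\alpha,N_\alpha,B_\alpha\}$ satisfies $T_\alpha'=\kappa_\alpha N_\alpha$, $N_\alpha'=-\kappa_\alpha T_\alpha+\tau_\alpha B_\alpha$, $B_\alpha'=-\tau_\alpha N_\alpha$. "Nonplanar" means that $\alpha$ is not contained in a plane (the torsion is not identically zero). A vector field $W$ along $\alpha$ is called $F$-constant (with respect to the Frenet frame) if $W'=D_\alpha\times W$, where $D_\alpha=\tau_\alpha T_\alpha+\kappa_\alpha B_\alpha$ is the Darboux vector; equivalently, $W=aT_\alpha+bN_\alpha+cB_\alpha$ with real constants $a,b,c$. It is normal if $W(s)$ lies in the normal plane $\mathrm{span}\{N_\alpha(s),B_\alpha(s)\}$ for every $s$. A curve $\alpha$ is a helix if there is a (without loss of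 generality unit) $F$-constant vector field $W$ along $\alpha$ forming a constant angle with a fixed direction $V$ (a nonzero constant vector), called an axis; it is a normal helix if $W$ is a normal vector field. *)

theory Defs
  imports "HOL-Analysis.Analysis"
begin

unbundle cross3_syntax

abbreviation vderiv :: "(real \<Rightarrow> 'a::real_normed_vector) \<Rightarrow> real \<Rightarrow> 'a" where
  "vderiv f \<equiv> \<lambda>s. vector_derivative f (at s)"

text \<open>Smoothness is meant for open sets \<open>S\<close>, where the two-sided derivatives at points of \<open>S\<close>
  depend only on the values of the function on \<open>S\<close>.\<close>

definition smooth_on :: "real set \<Rightarrow> (real \<Rightarrow> 'a::real_normed_vector) \<Rightarrow> bool" where
  "smooth_on S f \<longleftrightarrow> (\<forall>n. \<forall>s\<in>S. ((vderiv ^^ n) f) differentiable (at s))"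

definition arclength_parametrized_on :: "real set \<Rightarrow> (real \<Rightarrow> real ^ 3) \<Rightarrow> bool" where
  "arclength_parametrized_on I \<alpha> \<longleftrightarrow> smooth_on I \<alpha> \<and> (\<forall>s\<in>I. norm (vderiv \<alpha> s) = 1)"

definition contained_in_plane :: "(real ^ 3) set \<Rightarrow> bool" where
  "contained_in_plane X \<longleftrightarrow> (\<exists>n d. n \<noteq> 0 \<and> X \<subseteq> {x. n \<bullet> x = d})"

text \<open>The Frenet apparatus of an arclength parametrized curve. The curvature is nonnegative by
  definition, and the sign of the torsion is fixed by \<open>N' = - \<kappa> T + \<tau> B\<close>, that is
  \<open>B' = - \<tau> N\<close>.\<close>

definition frenet_T :: "(real \<Rightarrow> real ^ 3) \<Rightarrow> real \<Rightarrow> real ^ 3" where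
  "frenet_T \<alpha> s = vderiv \<alpha> s"

definition curvature :: "(real \<Rightarrow> real ^ 3) \<Rightarrow> real \<Rightarrow> real" where
  "curvature \<alpha> s = norm (vderiv (frenet_T \<alpha>) s)"

definition frenet_N :: "(real \<Rightarrow> real ^ 3) \<Rightarrow> real \<Rightarrow> real ^ 3" where
  "frenet_N \<alpha> s = (1 / curvature \<alpha> s) *\<^sub>R vderiv (frenet_T \<alpha>) s"

definition frenet_B :: "(real \<Rightarrow> real ^ 3) \<Rightarrow> real \<Rightarrow> real ^ 3" where
  "frenet_B \<alpha> s = frenet_T \<alpha> s \<times> frenet_N \<alpha> s"

definition torsion :: "(real \<Rightarrow> real ^ 3) \<Rightarrow> real \<Rightarrow> real" where
  "torsion \<alpha> s = vderiv (frenet_N \<alpha>) s \<bullet> frenet_B \<alpha> s"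

definition darboux :: "(real \<Rightarrow> real ^ 3) \<Rightarrow> real \<Rightarrow> real ^ 3" where
  "darboux \<alpha> s = torsion \<alpha> s *\<^sub>R frenet_T \<alpha> s + curvature \<alpha> s *\<^sub>R frenet_B \<alpha> s"

definition F_constant_on :: "real set \<Rightarrow> (real \<Rightarrow> real ^ 3) \<Rightarrow> (real \<Rightarrow> real ^ 3) \<Rightarrow> bool" where
  "F_constant_on I \<alpha> W \<longleftrightarrow>
     smooth_on I W \<and> (\<forall>s\<in>I. vderiv W s = darboux \<alpha> s \<times> W s)"

definition normal_field_on :: "real set \<Rightarrow> (real \<Rightarrow> real ^ 3) \<Rightarrow> (real \<Rightarrow> real ^ 3) \<Rightarrow> bool" where
  "normal_field_on I \<alpha> W \<longleftrightarrow> (\<forall>s\<in>I. W s \<in> span {frenet_N \<alpha> s, frenet_B \<alpha> s})"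

text \<open>The angle between \<open>W\<close> and the axis \<open>V\<close> is the constant \<open>\<pi>/2\<close>.\<close>

definition normal_helix_orthogonal_axis_on :: "real set \<Rightarrow> (real \<Rightarrow> real ^ 3) \<Rightarrow> bool" where
  "normal_helix_orthogonal_axis_on I \<alpha> \<longleftrightarrow>
     (\<exists>W V. F_constant_on I \<alpha> W \<and> normal_field_on I \<alpha> W \<and> (\<forall>s\<in>I. norm (W s) = 1) \<and>
            V \<noteq> 0 \<and> (\<forall>s\<in>I. W s \<bullet> V = 0))"

end

theory Submission
  imports Defs
begin

text \<open>
  Let \<open>W\<close> be a unit \<open>F\<close>-constant normal field. Its coordinates in the Frenet frame are constant, so
  \<open>W = b N + c B\<close> with \<open>b\<^sup>2 + c\<^sup>2 = 1\<close>, and the whole problem becomes one about the three functions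
  \<open>\<langle>T, V\<rangle>\<close>, \<open>\<langle>N, V\<rangle>\<close>, \<open>\<langle>B, V\<rangle>\<close>, which for a fixed \<open>V\<close> satisfy the Frenet equations.

  Necessity: the orthogonality \<open>b \<langle>N, V\<rangle> + c \<langle>B, V\<rangle> = 0\<close> says that
  \<open>(\<langle>N, V\<rangle>, \<langle>B, V\<rangle>) = p \<cdot> (-c, b)\<close> for a function \<open>p\<close>. Differentiating it gives
  \<open>b \<kappa> \<langle>T, V\<rangle> = \<tau> p\<close>, so that all coordinates of \<open>V\<close> are multiples of \<open>p\<close> as soon as \<open>b \<noteq> 0\<close>, and
  \<open>p\<close> has no zero because \<open>V \<noteq> 0\<close>. Differentiating once more and cancelling \<open>p\<close> gives
  \<open>(\<tau>/\<kappa>)' = - (c/b) (b\<^sup>2 \<kappa> + \<tau>\<^sup>2/\<kappa>)\<close>, which is the equation of the theorem with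
  \<open>tan \<theta> = c/b\<close> (lemma \<open>axis_imp_ratio_equation\<close>). The case \<open>b = 0\<close> would make the torsion vanish
  (lemma \<open>binormal_field_imp_torsion_zero\<close>), so that the curve would be planar.

  Sufficiency: the same computation shows what an axis has to look like up to a scalar factor, namely
  \<open>U = - \<tau>/(b \<kappa>) T + c N - b B\<close> with \<open>b = cos \<theta>\<close>, \<open>c = sin \<theta>\<close>. This field is orthogonal to
  \<open>b N + c B\<close>, has no zero, and the equation says precisely that \<open>U'\<close> is a multiple of \<open>U\<close>. Hence its
  direction \<open>U / |U|\<close> is constant, and it is the axis (lemma \<open>ratio_equation_imp_axis\<close>).
\<close>

section \<open>Smooth functions of one real variable\<close>

text \<open>Smoothness quantifies over all iterated derivatives of a function, and those of a product have
  no simple form. Counting derivatives one at a time allows induction on their number, with the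
  functions generalized.\<close>

primrec times_differentiable_on :: "nat \<Rightarrow> real set \<Rightarrow> (real \<Rightarrow> 'a::real_normed_vector) \<Rightarrow> bool" where
  "times_differentiable_on 0 S f \<longleftrightarrow> True"
| "times_differentiable_on (Suc n) S f \<longleftrightarrow>
     (\<forall>s\<in>S. f differentiable (at s)) \<and> times_differentiable_on n S (vderiv f)"

lemma times_differentiable_on_iff:
  "times_differentiable_on n S f \<longleftrightarrow> (\<forall>k<n. \<forall>s\<in>S. (vderiv ^^ k) f differentiable (at s))"
proof (induction n arbitrary: f)
  case (Suc n)
  have "(\<forall>k<Suc n. \<forall>s\<in>S. (vderiv ^^ k) f differentiable (at s)) \<longleftrightarrow>
      (\<forall>s\<in>S. f differentiable (at s)) \<and>
      (\<forall>k<n. \<forall>s\<in>S. (vderiv ^^ k) (vderiv f) differentiable (at s))"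
    by (simp add: All_less_Suc2 funpow_Suc_right del: funpow.simps(2))
  then show ?case
    by (simp add: Suc.IH)
qed simp

lemma smooth_on_iff_times_differentiable_on:
  "smooth_on S f \<longleftrightarrow> (\<forall>n. times_differentiable_on n S f)"
  unfolding smooth_on_def times_differentiable_on_iff by blast

lemma smooth_on_has_vector_derivative:
  assumes "smooth_on S f" "s \<in> S"
  shows "(f has_vector_derivative vderiv f s) (at s)"
proof -
  have "times_differentiable_on 1 S f"
    using assms(1) smooth_on_iff_times_differentiable_on by blast
  then show ?thesis
    using assms(2) by (simp flip: vector_derivative_works)
qed

lemma smooth_on_vderiv: "smooth_on S f \<Longrightarrow> smooth_on S (vderiv f)"
  unfolding smooth_on_iff_times_differentiable_on
  by (metis times_differentiable_on.simps(2))

lemma times_differentiable_on_SucD: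
  "times_differentiable_on (Suc n) S f \<Longrightarrow> times_differentiable_on n S f"
  by (simp add: times_differentiable_on_iff)

lemma has_vector_derivative_cong_open:
  assumes "open S" "s \<in> S" "\<And>x. x \<in> S \<Longrightarrow> f x = g x"
  shows "(f has_vector_derivative d) (at s) \<longleftrightarrow> (g has_vector_derivative d) (at s)"
  using assms by (metis has_vector_derivative_transform_within_open)

lemma times_differentiable_on_cong:
  assumes "open S" "\<And>s. s \<in> S \<Longrightarrow> f s = g s" "times_differentiable_on n S f"
  shows "times_differentiable_on n S g"
  using assms(2,3)
proof (induction n arbitrary: f g)
  case (Suc n)
  have deriv_f: "(f has_vector_derivative vderiv f s) (at s)" if "s \<in> S" for s
    using Suc.prems(2) that by (simp flip: vector_derivative_works)
  have deriv_g: "(g has_vector_derivative vderiv f s) (at s)" if "s \<in> S" for s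
    using deriv_f[OF that] has_vector_derivative_cong_open[OF assms(1) that, of f g] Suc.prems(1) by blast
  have "times_differentiable_on n S (vderiv g)"
    using Suc.prems(2) deriv_g
    by (intro Suc.IH[of "vderiv f" "vderiv g"]) (auto simp: vector_derivative_at[OF deriv_g])
  then show ?case
    using deriv_g by (auto intro: differentiableI_vector)
qed simp

lemma smooth_on_cong:
  "open S \<Longrightarrow> (\<And>s. s \<in> S \<Longrightarrow> f s = g s) \<Longrightarrow> smooth_on S f \<Longrightarrow> smooth_on S g"
  unfolding smooth_on_iff_times_differentiable_on using times_differentiable_on_cong by blast

lemma times_differentiable_on_SucI:
  assumes "open S" "\<And>s. s \<in> S \<Longrightarrow> (f has_vector_derivative f' s) (at s)"
    and "times_differentiable_on n S f'"
  shows "times_differentiable_on (Suc n) S f"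
proof -
  have "times_differentiable_on n S (vderiv f)"
    using vector_derivative_at[OF assms(2)]
    by (intro times_differentiable_on_cong[OF assms(1) _ assms(3)]) simp
  then show ?thesis
    using assms(2) by (auto intro: differentiableI_vector)
qed

lemma times_differentiable_on_SucE:
  assumes "times_differentiable_on (Suc n) S f" "s \<in> S"
  shows "(f has_vector_derivative vderiv f s) (at s)"
  using assms by (simp flip: vector_derivative_works)

lemma times_differentiable_on_add:
  assumes "open S" "times_differentiable_on n S f" "times_differentiable_on n S g"
  shows "times_differentiable_on n S (\<lambda>s. f s + g s)"
  using assms(2,3)
proof (induction n arbitrary: f g)
  case (Suc n)
  have "times_differentiable_on n S (\<lambda>s. vderiv f s + vderiv g s)"
    using Suc by simp
  then show ?case
    by (rule times_differentiable_on_SucI[OF assms(1), rotated])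
      (intro has_vector_derivative_add Suc.prems[THEN times_differentiable_on_SucE])
qed simp

lemma times_differentiable_on_bounded_linear:
  assumes "bounded_linear h" "open S" "times_differentiable_on n S f"
  shows "times_differentiable_on n S (\<lambda>s. h (f s))"
  using assms(3)
proof (induction n arbitrary: f)
  case (Suc n)
  have "times_differentiable_on n S (\<lambda>s. h (vderiv f s))"
    using Suc by simp
  then show ?case
    by (rule times_differentiable_on_SucI[OF assms(2), rotated])
      (intro bounded_linear.has_vector_derivative[OF assms(1)]
        Suc.prems[THEN times_differentiable_on_SucE])
qed simp

lemma times_differentiable_on_bounded_bilinear:
  assumes "bounded_bilinear h" "open S"
    and "times_differentiable_on n S f" "times_differentiable_on n S g"
  shows "times_differentiable_on n S (\<lambda>s. h (f s) (g s))"
  using assms(3,4)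
proof (induction n arbitrary: f g)
  case (Suc n)
  have "times_differentiable_on n S (\<lambda>s. h (f s) (vderiv g s) + h (vderiv f s) (g s))"
    using Suc.prems[THEN times_differentiable_on_SucD] Suc.prems
    by (intro times_differentiable_on_add[OF assms(2)] Suc.IH) auto
  then show ?case
    by (rule times_differentiable_on_SucI[OF assms(2), rotated])
      (intro bounded_bilinear.has_vector_derivative[OF assms(1)]
        Suc.prems[THEN times_differentiable_on_SucE])
qed simp

lemma smooth_on_add:
  "open S \<Longrightarrow> smooth_on S f \<Longrightarrow> smooth_on S g \<Longrightarrow> smooth_on S (\<lambda>s. f s + g s)"
  unfolding smooth_on_iff_times_differentiable_on using times_differentiable_on_add by blast

lemma smooth_on_bounded_linear:
  "bounded_linear h \<Longrightarrow> open S \<Longrightarrow> smooth_on S f \<Longrightarrow> smooth_on S (\<lambda>s. h (f s))"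
  unfolding smooth_on_iff_times_differentiable_on
  using times_differentiable_on_bounded_linear by blast

lemma smooth_on_bounded_bilinear:
  "bounded_bilinear h \<Longrightarrow> open S \<Longrightarrow> smooth_on S f \<Longrightarrow> smooth_on S g
    \<Longrightarrow> smooth_on S (\<lambda>s. h (f s) (g s))"
  unfolding smooth_on_iff_times_differentiable_on
  using times_differentiable_on_bounded_bilinear by blast

lemma bounded_bilinear_cross3: "bounded_bilinear cross3"
  using bilinear_conv_bounded_bilinear bilinear_cross by blast

lemmas smooth_on_inner = smooth_on_bounded_bilinear[OF bounded_bilinear_inner]
lemmas smooth_on_scaleR = smooth_on_bounded_bilinear[OF bounded_bilinear_scaleR]
lemmas smooth_on_cross3 = smooth_on_bounded_bilinear[OF bounded_bilinear_cross3]

lemma has_real_derivative_norm: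
  fixes u :: "real \<Rightarrow> 'a::real_inner"
  assumes "(u has_vector_derivative u') (at s)" "u s \<noteq> 0"
  shows "((\<lambda>x. norm (u x)) has_real_derivative (u s \<bullet> u') / norm (u s)) (at s)"
proof -
  have "((\<lambda>x. norm (u x)) has_derivative (\<lambda>h. (h *\<^sub>R u') \<bullet> sgn (u s))) (at s)"
    using has_derivative_compose[OF assms(1)[unfolded has_vector_derivative_def]
        has_derivative_norm[OF assms(2)]] by simp
  then show ?thesis
    by (rule has_derivative_imp_has_field_derivative)
      (simp add: sgn_div_norm inner_commute divide_inverse)
qed

text \<open>The factor \<open>\<rho> = 1/|u|\<close> solves \<open>\<rho>' = - \<langle>u, u'\<rangle> \<rho>\<^sup>3\<close>, an equation that bounds the
  differentiability of \<open>\<rho>'\<close> by that of \<open>\<rho>\<close>; so it gains one derivative at each step.\<close>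

lemma smooth_on_inverse_norm:
  fixes u :: "real \<Rightarrow> 'a::real_inner"
  assumes S: "open S" and u: "smooth_on S u" and nz: "\<And>s. s \<in> S \<Longrightarrow> u s \<noteq> 0"
  shows "smooth_on S (\<lambda>s. 1 / norm (u s))"
  unfolding smooth_on_iff_times_differentiable_on
proof
  fix n
  let ?\<rho> = "\<lambda>s. 1 / norm (u s)"
  show "times_differentiable_on n S ?\<rho>"
  proof (induction n)
    case (Suc n)
    have "(?\<rho> has_vector_derivative - (u s \<bullet> vderiv u s) * (?\<rho> s * (?\<rho> s * ?\<rho> s))) (at s)"
      if "s \<in> S" for s
      unfolding has_real_derivative_iff_has_vector_derivative[symmetric]
      using nz[OF that]
      by (auto intro!: derivative_eq_intros
          has_real_derivative_norm[OF smooth_on_has_vector_derivative[OF u that]]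
          simp: divide_simps)
    moreover have "smooth_on S (\<lambda>s. - (u s \<bullet> vderiv u s))"
      by (intro smooth_on_bounded_linear[OF bounded_linear_minus[OF bounded_linear_ident]]
          smooth_on_inner smooth_on_vderiv S u)
    then have "times_differentiable_on n S
        (\<lambda>s. - (u s \<bullet> vderiv u s) * (?\<rho> s * (?\<rho> s * ?\<rho> s)))"
      using Suc unfolding smooth_on_iff_times_differentiable_on
      by (intro times_differentiable_on_bounded_bilinear[OF bounded_bilinear_mult] S) auto
    ultimately show ?case
      by (intro times_differentiable_on_SucI[OF S]) auto
  qed simp
qed

lemma DERIV_unique_open:
  fixes f g :: "real \<Rightarrow> real"
  assumes "open S" "s \<in> S" "\<And>x. x \<in> S \<Longrightarrow> f x = g x"
    and "(f has_real_derivative d) (at s)" "(g has_real_derivative e) (at s)"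
  shows "d = e"
  using has_field_derivative_transform_within_open[OF assms(4,1,2,3)] assms(5) by (rule DERIV_unique)

lemma has_vector_derivative_inner_const:
  assumes "(f has_vector_derivative f') (at s)"
  shows "((\<lambda>x. f x \<bullet> v) has_real_derivative f' \<bullet> v) (at s)"
  using bounded_linear.has_vector_derivative[OF bounded_linear_inner_left assms]
  by (simp add: has_real_derivative_iff_has_vector_derivative)

section \<open>Orthonormal frames in three dimensions\<close>

text \<open>A vector orthogonal to \<open>t\<close> and \<open>n\<close> has vanishing cross product with \<open>t \<times> n\<close>; if it is orthogonal
  to \<open>t \<times> n\<close> as well, it is zero. This is applied to the difference of the two sides.\<close>

lemma orthonormal_cross3_expansion:
  fixes t n v :: "real ^ 3"
  assumes "norm t = 1" "norm n = 1" "t \<bullet> n = 0"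
  shows "v = (v \<bullet> t) *\<^sub>R t + (v \<bullet> n) *\<^sub>R n + (v \<bullet> (t \<times> n)) *\<^sub>R (t \<times> n)"
proof -
  define w where "w = v - ((v \<bullet> t) *\<^sub>R t + (v \<bullet> n) *\<^sub>R n + (v \<bullet> (t \<times> n)) *\<^sub>R (t \<times> n))"
  have norm_cross: "norm (t \<times> n) = 1"
    using norm_cross_dot[of t n] assms by (simp add: power2_eq_1_iff) (smt (verit) norm_ge_zero)
  have dots: "t \<bullet> t = 1" "n \<bullet> n = 1" "(t \<times> n) \<bullet> (t \<times> n) = 1" "n \<bullet> t = 0"
    using assms norm_cross by (simp_all add: norm_eq_1 inner_commute)
  have "w \<bullet> t = 0" "w \<bullet> n = 0" "w \<bullet> (t \<times> n) = 0"
    unfolding w_def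
    by (simp_all add: inner_diff_left inner_add_left dots assms dot_cross_self)
  moreover have "w \<times> (t \<times> n) = (w \<bullet> n) *\<^sub>R t - (w \<bullet> t) *\<^sub>R n"
    by (simp add: Lagrange)
  ultimately have "norm w = 0"
    using norm_cross_dot[of w "t \<times> n"] norm_cross by simp
  then show ?thesis
    by (simp add: w_def)
qed

section \<open>The Frenet equations\<close>

locale frenet_curve =
  fixes I :: "real set" and \<alpha> :: "real \<Rightarrow> real ^ 3"
  assumes open_I: "open I" and interval_I: "is_interval I"
    and arclength: "arclength_parametrized_on I \<alpha>"
    and curvature_pos: "s \<in> I \<Longrightarrow> curvature \<alpha> s > 0"
begin

abbreviation T where "T \<equiv> frenet_T \<alpha>"
abbreviation N where "N \<equiv> frenet_N \<alpha>"
abbreviation B where "B \<equiv> frenet_B \<alpha>"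
abbreviation \<kappa> where "\<kappa> \<equiv> curvature \<alpha>"
abbreviation \<tau> where "\<tau> \<equiv> torsion \<alpha>"

lemma smooth_T: "smooth_on I T"
  using arclength smooth_on_vderiv unfolding arclength_parametrized_on_def frenet_T_def[abs_def]
  by blast

lemma smooth_N: "smooth_on I N"
proof -
  have "vderiv T s \<noteq> 0" if "s \<in> I" for s
    using curvature_pos[OF that] by (simp add: curvature_def)
  then show ?thesis
    unfolding frenet_N_def[abs_def] curvature_def
    by (intro smooth_on_scaleR smooth_on_inverse_norm smooth_on_vderiv smooth_T open_I)
qed

lemma smooth_B: "smooth_on I B"
  unfolding frenet_B_def[abs_def] by (intro smooth_on_cross3 smooth_T smooth_N open_I)

lemma vderiv_T: "s \<in> I \<Longrightarrow> vderiv T s = \<kappa> s *\<^sub>R N s"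
  using curvature_pos[of s] by (simp add: frenet_N_def)

lemma norm_T: "s \<in> I \<Longrightarrow> norm (T s) = 1"
  using arclength by (simp add: arclength_parametrized_on_def frenet_T_def)

lemma norm_N: "s \<in> I \<Longrightarrow> norm (N s) = 1"
  using curvature_pos[of s] by (simp add: frenet_N_def) (simp add: curvature_def)

text \<open>Writing the curvature as \<open>\<langle>T', N\<rangle>\<close> gives its smoothness from that of the frame.\<close>

lemma smooth_curvature: "smooth_on I \<kappa>"
proof (rule smooth_on_cong[OF open_I])
  show "smooth_on I (\<lambda>s. vderiv T s \<bullet> N s)"
    by (intro smooth_on_inner smooth_on_vderiv smooth_T smooth_N open_I)
  show "vderiv T s \<bullet> N s = \<kappa> s" if "s \<in> I" for s
    using norm_N[OF that] by (simp add: vderiv_T[OF that] norm_eq_1)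
qed

lemma smooth_torsion: "smooth_on I \<tau>"
  unfolding torsion_def[abs_def]
  by (intro smooth_on_inner smooth_on_vderiv smooth_B smooth_N open_I)

lemma inner_vderiv_of_constant_inner:
  assumes "smooth_on I f" "smooth_on I g" "\<And>x. x \<in> I \<Longrightarrow> f x \<bullet> g x = (d::real)" "s \<in> I"
  shows "f s \<bullet> vderiv g s + vderiv f s \<bullet> g s = 0"
proof (rule DERIV_unique_open[OF open_I assms(4,3)])
  show "((\<lambda>x. f x \<bullet> g x) has_real_derivative f s \<bullet> vderiv g s + vderiv f s \<bullet> g s) (at s)"
    unfolding has_real_derivative_iff_has_vector_derivative
    by (intro bounded_bilinear.has_vector_derivative[OF bounded_bilinear_inner]
        smooth_on_has_vector_derivative[OF _ assms(4)] assms(1,2))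
qed auto

lemma T_inner_N:
  assumes "s \<in> I"
  shows "T s \<bullet> N s = 0"
proof -
  have "T s \<bullet> vderiv T s + vderiv T s \<bullet> T s = 0"
    using norm_T by (intro inner_vderiv_of_constant_inner[of T T 1] smooth_T assms)
      (simp add: norm_eq_1)
  then show ?thesis
    using curvature_pos[OF assms] by (simp add: inner_commute vderiv_T[OF assms])
qed

lemma frame_inner:
  assumes "s \<in> I"
  shows "T s \<bullet> T s = 1" "N s \<bullet> N s = 1" "B s \<bullet> B s = 1"
    "T s \<bullet> N s = 0" "N s \<bullet> T s = 0" "T s \<bullet> B s = 0" "B s \<bullet> T s = 0" "N s \<bullet> B s = 0" "B s \<bullet> N s = 0"
proof -
  have "(norm (B s))\<^sup>2 = 1"
    using norm_cross_dot[of "T s" "N s"] norm_T[OF assms] norm_N[OF assms] T_inner_N[OF assms]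
    by (simp add: frenet_B_def)
  then show "B s \<bullet> B s = 1"
    by (simp add: power2_norm_eq_inner)
qed (use norm_T[OF assms] norm_N[OF assms] T_inner_N[OF assms] in
    \<open>simp_all add: norm_eq_1 inner_commute frenet_B_def dot_cross_self\<close>)

lemma frame_expansion:
  assumes "s \<in> I"
  shows "v = (v \<bullet> T s) *\<^sub>R T s + (v \<bullet> N s) *\<^sub>R N s + (v \<bullet> B s) *\<^sub>R B s"
  unfolding frenet_B_def
  by (intro orthonormal_cross3_expansion norm_T norm_N T_inner_N assms)

lemma vderiv_N:
  assumes "s \<in> I"
  shows "vderiv N s = - \<kappa> s *\<^sub>R T s + \<tau> s *\<^sub>R B s"
proof -
  have "N s \<bullet> vderiv N s + vderiv N s \<bullet> N s = 0"
    by (rule inner_vderiv_of_constant_inner[of N N 1]) (auto simp: smooth_N frame_inner assms)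
  then have "vderiv N s \<bullet> N s = 0"
    by (simp add: inner_commute)
  moreover have "T s \<bullet> vderiv N s + vderiv T s \<bullet> N s = 0"
    by (rule inner_vderiv_of_constant_inner[of T N 0])
      (auto simp: smooth_T smooth_N frame_inner assms)
  then have "vderiv N s \<bullet> T s = - \<kappa> s"
    by (simp add: inner_commute vderiv_T frame_inner assms)
  ultimately show ?thesis
    using frame_expansion[OF assms, of "vderiv N s"] by (simp add: torsion_def)
qed

lemma T_cross_B:
  assumes "s \<in> I"
  shows "T s \<times> B s = - N s"
  using Lagrange[of "T s" "T s" "N s"] by (simp add: frame_inner assms flip: frenet_B_def)

lemma N_cross_B:
  assumes "s \<in> I"
  shows "N s \<times> B s = T s"
  using Lagrange[of "N s" "T s" "N s"] by (simp add: frame_inner assms flip: frenet_B_def)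

lemma vderiv_B:
  assumes "s \<in> I"
  shows "vderiv B s = - \<tau> s *\<^sub>R N s"
proof -
  have "(B has_vector_derivative T s \<times> vderiv N s + vderiv T s \<times> N s) (at s)"
    unfolding frenet_B_def[abs_def]
    by (intro bounded_bilinear.has_vector_derivative[OF bounded_bilinear_cross3]
        smooth_on_has_vector_derivative[OF _ assms] smooth_T smooth_N)
  then have "vderiv B s = T s \<times> vderiv N s + vderiv T s \<times> N s"
    by (rule vector_derivative_at)
  also have "\<dots> = - \<tau> s *\<^sub>R N s"
    by (simp add: vderiv_N vderiv_T T_cross_B assms Cross3.right_diff_distrib
        cross_mult_right cross_mult_left)
  finally show ?thesis .
qed

lemma frenet_equations:
  assumes "s \<in> I"
  shows "(T has_vector_derivative \<kappa> s *\<^sub>R N s) (at s)"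
    "(N has_vector_derivative - \<kappa> s *\<^sub>R T s + \<tau> s *\<^sub>R B s) (at s)"
    "(B has_vector_derivative - \<tau> s *\<^sub>R N s) (at s)"
  using smooth_on_has_vector_derivative[OF smooth_T assms]
    smooth_on_has_vector_derivative[OF smooth_N assms]
    smooth_on_has_vector_derivative[OF smooth_B assms]
  by (simp_all add: vderiv_T vderiv_N vderiv_B assms)

lemma torsion_DERIV: "s \<in> I \<Longrightarrow> (\<tau> has_real_derivative vderiv \<tau> s) (at s)"
  by (simp add: has_real_derivative_iff_has_vector_derivative
      smooth_on_has_vector_derivative[OF smooth_torsion])

lemma ratio_DERIV:
  assumes "s \<in> I"
  shows "((\<lambda>u. \<tau> u / \<kappa> u) has_real_derivative deriv (\<lambda>u. \<tau> u / \<kappa> u) s) (at s)"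
proof -
  have "\<kappa> field_differentiable (at s)" "\<tau> field_differentiable (at s)"
    using smooth_on_has_vector_derivative[OF smooth_curvature assms]
      smooth_on_has_vector_derivative[OF smooth_torsion assms]
    by (auto simp: field_differentiable_def has_real_derivative_iff_has_vector_derivative)
  then have "(\<lambda>u. \<tau> u / \<kappa> u) field_differentiable (at s)"
    using curvature_pos[OF assms] by (intro field_differentiable_divide) auto
  then show ?thesis
    by (rule field_differentiable_derivI)
qed

lemma derivative_zero_imp_constant:
  fixes f :: "real \<Rightarrow> 'a::real_normed_vector"
  assumes "\<And>s. s \<in> I \<Longrightarrow> (f has_vector_derivative 0) (at s)"
  obtains c where "\<And>s. s \<in> I \<Longrightarrow> f s = c"
proof -
  have "convex I"
    using interval_I is_interval_convex by blast
  then show thesis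
    using has_vector_derivative_zero_constant[of I f] assms that
      has_vector_derivative_at_within by metis
qed

lemma torsion_zero_imp_planar:
  assumes "\<And>s. s \<in> I \<Longrightarrow> \<tau> s = 0"
  shows "contained_in_plane (\<alpha> ` I)"
proof (cases "I = {}")
  case True
  show ?thesis
    unfolding contained_in_plane_def True by (rule exI[of _ "axis 1 1"]) simp
next
  case False
  then obtain s0 where s0: "s0 \<in> I" by blast
  have "(B has_vector_derivative 0) (at s)" if "s \<in> I" for s
    using frenet_equations(3)[OF that] assms[OF that] by simp
  then obtain n where n: "\<And>s. s \<in> I \<Longrightarrow> B s = n"
    using derivative_zero_imp_constant[of B] by blast
  have "((\<lambda>x. \<alpha> x \<bullet> n) has_vector_derivative 0) (at s)" if "s \<in> I" for s
  proof -
    have "(\<alpha> has_vector_derivative T s) (at s)"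
      using arclength that smooth_on_has_vector_derivative[of I \<alpha> s]
      by (simp add: arclength_parametrized_on_def frenet_T_def)
    moreover have "T s \<bullet> n = 0"
      using frame_inner(6)[OF that] n[OF that] by simp
    ultimately show ?thesis
      using has_vector_derivative_inner_const[of \<alpha> "T s" s n]
      by (simp add: has_real_derivative_iff_has_vector_derivative)
  qed
  then obtain d where "\<And>s. s \<in> I \<Longrightarrow> \<alpha> s \<bullet> n = d"
    using derivative_zero_imp_constant[of "\<lambda>x. \<alpha> x \<bullet> n"] by blast
  moreover have "n \<noteq> 0"
    using frame_inner(3)[OF s0] n[OF s0] by auto
  ultimately show ?thesis
    unfolding contained_in_plane_def by (intro exI[of _ n] exI[of _ d]) (auto simp: inner_commute)
qed

section \<open>\<open>F\<close>-constant normal fields\<close>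

lemma darboux_cross_frame:
  assumes "s \<in> I"
  shows "darboux \<alpha> s \<times> N s = - \<kappa> s *\<^sub>R T s + \<tau> s *\<^sub>R B s"
    and "darboux \<alpha> s \<times> B s = - \<tau> s *\<^sub>R N s"
proof -
  have "B s \<times> N s = - T s"
    using N_cross_B[OF assms] cross_skew[of "B s" "N s"] by simp
  moreover have "T s \<times> N s = B s"
    by (simp add: frenet_B_def)
  ultimately show "darboux \<alpha> s \<times> N s = - \<kappa> s *\<^sub>R T s + \<tau> s *\<^sub>R B s"
    by (simp add: darboux_def cross_add_left cross_mult_left)
  show "darboux \<alpha> s \<times> B s = - \<tau> s *\<^sub>R N s"
    by (simp add: darboux_def cross_add_left cross_mult_left T_cross_B assms)
qed

text \<open>The Frenet frame itself solves \<open>X' = D \<times> X\<close>, and the inner product of two solutions is constant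
  because \<open>\<langle>D \<times> X, Y\<rangle> + \<langle>X, D \<times> Y\<rangle> = 0\<close>.\<close>

lemma F_constant_normal_field_coordinates:
  assumes W: "F_constant_on I \<alpha> W" "normal_field_on I \<alpha> W"
  obtains b c where "\<And>s. s \<in> I \<Longrightarrow> W s = b *\<^sub>R N s + c *\<^sub>R B s"
proof -
  have inner_constant: "\<exists>b. \<forall>s\<in>I. W s \<bullet> X s = b"
    if X: "\<And>s. s \<in> I \<Longrightarrow> (X has_vector_derivative darboux \<alpha> s \<times> X s) (at s)" for X
  proof -
    have "((\<lambda>x. W x \<bullet> X x) has_vector_derivative 0) (at s)" if "s \<in> I" for s
    proof -
      have "(W has_vector_derivative darboux \<alpha> s \<times> W s) (at s)"
        using W(1) that smooth_on_has_vector_derivative[of I W s] by (simp add: F_constant_on_def)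
      from bounded_bilinear.has_vector_derivative[OF bounded_bilinear_inner this X[OF that]]
      have "((\<lambda>x. W x \<bullet> X x) has_vector_derivative
          W s \<bullet> (darboux \<alpha> s \<times> X s) + (darboux \<alpha> s \<times> W s) \<bullet> X s) (at s)" .
      moreover have "W s \<bullet> (darboux \<alpha> s \<times> X s) + (darboux \<alpha> s \<times> W s) \<bullet> X s = 0"
        by (simp add: cross3_simps)
      ultimately show ?thesis
        by simp
    qed
    then obtain b where "\<And>s. s \<in> I \<Longrightarrow> W s \<bullet> X s = b"
      using derivative_zero_imp_constant[of "\<lambda>x. W x \<bullet> X x"] by blast
    then show ?thesis
      by blast
  qed
  obtain b c where bc: "\<And>s. s \<in> I \<Longrightarrow> W s \<bullet> N s = b" "\<And>s. s \<in> I \<Longrightarrow> W s \<bullet> B s = c"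
    using inner_constant[of N] inner_constant[of B] frenet_equations(2,3) by (auto simp: darboux_cross_frame)
  have "W s = b *\<^sub>R N s + c *\<^sub>R B s" if s: "s \<in> I" for s
  proof -
    have "W s \<in> span {N s, B s}"
      using W(2) s by (simp add: normal_field_on_def)
    then obtain x y where "W s = x *\<^sub>R N s + y *\<^sub>R B s"
      by (auto simp: span_insert span_singleton algebra_simps)
    then show ?thesis
      using bc[OF s] by (simp add: inner_add_left frame_inner s)
  qed
  then show thesis
    by (rule that)
qed

lemma constant_coordinates_F_constant:
  "F_constant_on I \<alpha> (\<lambda>s. b *\<^sub>R N s + c *\<^sub>R B s)"
  unfolding F_constant_on_def
proof (intro conjI ballI)
  show "smooth_on I (\<lambda>s. b *\<^sub>R N s + c *\<^sub>R B s)"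
    by (intro smooth_on_add smooth_on_bounded_linear[OF bounded_linear_scaleR_right]
        smooth_N smooth_B open_I)
  fix s assume s: "s \<in> I"
  have "((\<lambda>s. b *\<^sub>R N s + c *\<^sub>R B s) has_vector_derivative
      b *\<^sub>R (- \<kappa> s *\<^sub>R T s + \<tau> s *\<^sub>R B s) + c *\<^sub>R (- \<tau> s *\<^sub>R N s)) (at s)"
    by (intro has_vector_derivative_add frenet_equations s
        bounded_linear.has_vector_derivative[OF bounded_linear_scaleR_right])
  from vector_derivative_at[OF this]
  show "vderiv (\<lambda>s. b *\<^sub>R N s + c *\<^sub>R B s) s = darboux \<alpha> s \<times> (b *\<^sub>R N s + c *\<^sub>R B s)"
    by (simp only: cross_add_right cross_mult_right darboux_cross_frame[OF s])
qed

lemma norm_unit_normal_combination: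
  assumes "s \<in> I"
  shows "norm (b *\<^sub>R N s + c *\<^sub>R B s) = 1 \<longleftrightarrow> b\<^sup>2 + c\<^sup>2 = 1"
  by (simp add: norm_eq_1 inner_add_left inner_add_right frame_inner assms power2_eq_square)

section \<open>The axis and the ratio of torsion to curvature\<close>

lemma axis_coordinates_DERIV:
  assumes "s \<in> I"
  shows "((\<lambda>x. T x \<bullet> V) has_real_derivative \<kappa> s * (N s \<bullet> V)) (at s)"
    "((\<lambda>x. N x \<bullet> V) has_real_derivative - \<kappa> s * (T s \<bullet> V) + \<tau> s * (B s \<bullet> V)) (at s)"
    "((\<lambda>x. B x \<bullet> V) has_real_derivative - \<tau> s * (N s \<bullet> V)) (at s)"
  using frenet_equations[OF assms, THEN has_vector_derivative_inner_const, of V]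
  by (simp_all add: inner_add_left inner_diff_left)

lemma frame_coordinates_zero_imp_zero:
  assumes "s \<in> I" "T s \<bullet> V = 0" "N s \<bullet> V = 0" "B s \<bullet> V = 0"
  shows "V = 0"
  using frame_expansion[OF assms(1), of V] assms(2-4) by (simp add: inner_commute)

text \<open>If \<open>V\<close> is orthogonal to \<open>B\<close>, then \<open>\<tau> \<langle>N, V\<rangle> = 0\<close>. Where \<open>\<tau> \<noteq> 0\<close>, differentiating this relation
  shows that \<open>\<langle>T, V\<rangle>\<close> vanishes along with \<open>\<langle>N, V\<rangle>\<close>, and nothing is left of \<open>V\<close>.\<close>

lemma binormal_field_imp_torsion_zero:
  assumes B: "\<And>x. x \<in> I \<Longrightarrow> B x \<bullet> V = 0" and V: "V \<noteq> 0" and s: "s \<in> I"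
  shows "\<tau> s = 0"
proof (rule ccontr)
  assume nz: "\<tau> s \<noteq> 0"
  have tau_N: "\<tau> x * (N x \<bullet> V) = 0" if "x \<in> I" for x
    using DERIV_unique_open[OF open_I that B axis_coordinates_DERIV(3)[OF that] DERIV_const] by simp
  then have N: "N s \<bullet> V = 0"
    using nz tau_N[OF s] by simp
  have "((\<lambda>x. \<tau> x * (N x \<bullet> V)) has_real_derivative
      vderiv \<tau> s * (N s \<bullet> V) + (- \<kappa> s * (T s \<bullet> V) + \<tau> s * (B s \<bullet> V)) * \<tau> s) (at s)"
    by (intro DERIV_mult torsion_DERIV axis_coordinates_DERIV s)
  from DERIV_unique_open[OF open_I s tau_N this DERIV_const]
  have "T s \<bullet> V = 0"
    using N nz curvature_pos[OF s] B[OF s] by simp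
  then show False
    using frame_coordinates_zero_imp_zero[OF s] N B[OF s] V by blast
qed

text \<open>The orthogonality relation leaves one function \<open>p\<close> to describe \<open>V\<close> in the frame, and its
  derivative is one linear relation that expresses \<open>\<langle>T, V\<rangle>\<close> by \<open>p\<close> in the form
  \<open>b \<langle>T, V\<rangle> = (\<tau>/\<kappa>) p\<close>. Differentiating this form brings in \<open>(\<tau>/\<kappa>)'\<close>; all other terms are
  multiples of \<open>p\<close> again, which cancels.\<close>

lemma axis_imp_ratio_equation:
  assumes orth: "\<And>x. x \<in> I \<Longrightarrow> (b *\<^sub>R N x + c *\<^sub>R B x) \<bullet> V = 0"
    and bc: "b\<^sup>2 + c\<^sup>2 = 1" and b: "b \<noteq> 0" and V: "V \<noteq> 0" and s: "s \<in> I"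
  shows "deriv (\<lambda>u. \<tau> u / \<kappa> u) s = - (c / b) * (b\<^sup>2 * \<kappa> s + (\<tau> s)\<^sup>2 / \<kappa> s)"
proof -
  define p where "p x = b * (B x \<bullet> V) - c * (N x \<bullet> V)" for x
  define q where "q x = \<tau> x / \<kappa> x" for x
  have orth': "b * (N x \<bullet> V) + c * (B x \<bullet> V) = 0" if "x \<in> I" for x
    using orth[OF that] by (simp add: inner_add_left)
  have N: "N x \<bullet> V = - c * p x" and B: "B x \<bullet> V = b * p x" if "x \<in> I" for x
    using orth'[OF that] bc unfolding p_def by algebra+
  have T: "b * \<kappa> x * (T x \<bullet> V) = \<tau> x * p x" if x: "x \<in> I" for x
  proof -
    have "((\<lambda>x. b * (N x \<bullet> V) + c * (B x \<bullet> V)) has_real_derivative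
        b * (- \<kappa> x * (T x \<bullet> V) + \<tau> x * (B x \<bullet> V)) + c * (- \<tau> x * (N x \<bullet> V))) (at x)"
      by (intro DERIV_add DERIV_cmult axis_coordinates_DERIV x)
    from DERIV_unique_open[OF open_I x orth' this DERIV_const] show ?thesis
      unfolding p_def by algebra
  qed
  \<comment> \<open>At a zero of \<open>p\<close> all three coordinates of \<open>V\<close> would vanish.\<close>
  have "p s \<noteq> 0"
  proof
    assume "p s = 0"
    then have "T s \<bullet> V = 0" "N s \<bullet> V = 0" "B s \<bullet> V = 0"
      using T[OF s] N[OF s] B[OF s] b curvature_pos[OF s] by auto
    then show False
      using frame_coordinates_zero_imp_zero[OF s] V by blast
  qed
  have "(p has_real_derivative
      b * (- \<tau> s * (N s \<bullet> V)) - c * (- \<kappa> s * (T s \<bullet> V) + \<tau> s * (B s \<bullet> V))) (at s)"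
    unfolding p_def[abs_def] by (intro DERIV_diff DERIV_cmult axis_coordinates_DERIV s)
  then have "(p has_real_derivative c * \<kappa> s * (T s \<bullet> V)) (at s)"
    by (rule DERIV_cong) (simp add: N[OF s] B[OF s] algebra_simps)
  from DERIV_mult[OF ratio_DERIV[OF s] this]
  have "((\<lambda>x. q x * p x) has_real_derivative
      deriv (\<lambda>u. \<tau> u / \<kappa> u) s * p s + c * \<kappa> s * (T s \<bullet> V) * q s) (at s)"
    by (simp add: q_def)
  moreover have "((\<lambda>x. b * (T x \<bullet> V)) has_real_derivative b * (\<kappa> s * (N s \<bullet> V))) (at s)"
    by (intro DERIV_cmult axis_coordinates_DERIV s)
  moreover have "b * (T x \<bullet> V) = q x * p x" if "x \<in> I" for x
    using T[OF that] curvature_pos[OF that] by (simp add: q_def field_simps)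
  ultimately have "b * (\<kappa> s * (N s \<bullet> V)) =
      deriv (\<lambda>u. \<tau> u / \<kappa> u) s * p s + c * \<kappa> s * (T s \<bullet> V) * q s"
    by (metis (no_types, lifting) DERIV_unique_open[OF open_I s])
  moreover have "\<kappa> s * (T s \<bullet> V) = \<tau> s * p s / b"
    using T[OF s] b by (simp add: field_simps)
  ultimately have "p s * (deriv (\<lambda>u. \<tau> u / \<kappa> u) s) = p s * (- b * c * \<kappa> s - c / b * \<tau> s * q s)"
    by (simp add: N[OF s] algebra_simps)
  then have "deriv (\<lambda>u. \<tau> u / \<kappa> u) s = - b * c * \<kappa> s - c / b * \<tau> s * q s"
    using \<open>p s \<noteq> 0\<close> by simp
  also have "\<dots> = - (c / b) * (b\<^sup>2 * \<kappa> s + (\<tau> s)\<^sup>2 / \<kappa> s)"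
    using b by (simp add: q_def power2_eq_square field_simps)
  finally show ?thesis .
qed

text \<open>A vector field whose derivative is always parallel to it has a constant direction: \<open>|U|\<close>
  satisfies the same linear equation as \<open>U\<close>, so that their quotient is constant.\<close>

lemma parallel_derivative_imp_constant_direction:
  fixes U :: "real \<Rightarrow> real ^ 3"
  assumes U': "\<And>s. s \<in> I \<Longrightarrow> (U has_vector_derivative \<mu> s *\<^sub>R U s) (at s)"
    and nz: "\<And>s. s \<in> I \<Longrightarrow> U s \<noteq> 0"
  obtains V where "\<And>s. s \<in> I \<Longrightarrow> (1 / norm (U s)) *\<^sub>R U s = V"
proof -
  have "((\<lambda>s. (1 / norm (U s)) *\<^sub>R U s) has_vector_derivative 0) (at s)" if s: "s \<in> I" for s
  proof -
    have n: "((\<lambda>x. norm (U x)) has_real_derivative \<mu> s * norm (U s)) (at s)"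
      using has_real_derivative_norm[OF U'[OF s] nz[OF s]] nz[OF s]
      by (simp add: power2_norm_eq_inner[symmetric] power2_eq_square)
    have "((\<lambda>x. 1 / norm (U x)) has_real_derivative - \<mu> s / norm (U s)) (at s)"
      using nz[OF s] by (auto intro!: derivative_eq_intros n)
    from has_vector_derivative_scaleR[OF this U'[OF s]] show ?thesis
      by simp
  qed
  then show thesis
    using derivative_zero_imp_constant[of "\<lambda>s. (1 / norm (U s)) *\<^sub>R U s"] that by blast
qed

text \<open>By the necessary relations an axis is \<open>- p U\<close> for the field \<open>U\<close> below. The \<open>N\<close>- and
  \<open>B\<close>-components of \<open>U' = - (c/b) \<tau> U\<close> hold for every curve; its \<open>T\<close>-component is the equation
  for \<open>(\<tau>/\<kappa>)'\<close>.\<close>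

lemma ratio_equation_imp_axis:
  assumes ratio: "\<And>s. s \<in> I \<Longrightarrow>
      deriv (\<lambda>u. \<tau> u / \<kappa> u) s = - (c / b) * (b\<^sup>2 * \<kappa> s + (\<tau> s)\<^sup>2 / \<kappa> s)"
    and bc: "b\<^sup>2 + c\<^sup>2 = 1" and b: "b \<noteq> 0" and nonempty: "I \<noteq> {}"
  obtains V where "V \<noteq> 0" "\<And>s. s \<in> I \<Longrightarrow> (b *\<^sub>R N s + c *\<^sub>R B s) \<bullet> V = 0"
proof -
  define U where "U s = (- (\<tau> s / \<kappa> s) / b) *\<^sub>R T s + c *\<^sub>R N s - b *\<^sub>R B s" for s
  have deriv_U: "(U has_vector_derivative (- (c / b) * \<tau> s) *\<^sub>R U s) (at s)" if s: "s \<in> I" for s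
  proof -
    let ?q' = "deriv (\<lambda>u. \<tau> u / \<kappa> u) s"
    have "((\<lambda>x. - (\<tau> x / \<kappa> x) / b) has_real_derivative - ?q' / b) (at s)"
      by (intro DERIV_cdivide DERIV_minus ratio_DERIV s)
    then have "(U has_vector_derivative
        (- (\<tau> s / \<kappa> s) / b) *\<^sub>R (\<kappa> s *\<^sub>R N s) + (- ?q' / b) *\<^sub>R T s
        + c *\<^sub>R (- \<kappa> s *\<^sub>R T s + \<tau> s *\<^sub>R B s) - b *\<^sub>R (- \<tau> s *\<^sub>R N s)) (at s)"
      unfolding U_def[abs_def]
      by (intro has_vector_derivative_diff has_vector_derivative_add has_vector_derivative_scaleR
          bounded_linear.has_vector_derivative[OF bounded_linear_scaleR_right]
          frenet_equations s)
    moreover have "(- (\<tau> s / \<kappa> s) / b) *\<^sub>R (\<kappa> s *\<^sub>R N s) + (- ?q' / b) *\<^sub>R T s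
        + c *\<^sub>R (- \<kappa> s *\<^sub>R T s + \<tau> s *\<^sub>R B s) - b *\<^sub>R (- \<tau> s *\<^sub>R N s)
        = (- ?q' / b - c * \<kappa> s) *\<^sub>R T s + (- (\<tau> s / b) + b * \<tau> s) *\<^sub>R N s + (c * \<tau> s) *\<^sub>R B s"
      using curvature_pos[OF s] by (simp add: algebra_simps)
    moreover have "- ?q' / b - c * \<kappa> s = - (c / b) * \<tau> s * (- (\<tau> s / \<kappa> s) / b)"
      using b curvature_pos[OF s] by (simp add: ratio[OF s] field_simps power2_eq_square)
    moreover have "- (\<tau> s / b) + b * \<tau> s = - (c / b) * \<tau> s * c"
    proof -
      have "- (\<tau> s / b) + b * \<tau> s = - (\<tau> s * (1 - b\<^sup>2)) / b"
        using b by (simp add: field_simps power2_eq_square)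
      also have "1 - b\<^sup>2 = c\<^sup>2"
        using bc by simp
      finally show ?thesis
        by (simp add: power2_eq_square)
    qed
    moreover have "c * \<tau> s = - (- (c / b) * \<tau> s * b)"
      using b by simp
    ultimately show ?thesis
      by (simp only: U_def scaleR_right_diff_distrib scaleR_right_distrib scaleR_scaleR
          scaleR_minus_left add_uminus_conv_diff)
  qed
  have U_nz: "U s \<noteq> 0" if s: "s \<in> I" for s
  proof
    assume "U s = 0"
    moreover have "U s \<bullet> B s = - b"
      by (simp add: U_def inner_add_left inner_diff_left frame_inner s)
    ultimately show False
      using b by simp
  qed
  obtain V where V: "\<And>s. s \<in> I \<Longrightarrow> (1 / norm (U s)) *\<^sub>R U s = V"
    using parallel_derivative_imp_constant_direction[OF deriv_U U_nz] by blast
  show thesis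
  proof (rule that)
    show "V \<noteq> 0"
      using nonempty U_nz V by fastforce
    show "(b *\<^sub>R N s + c *\<^sub>R B s) \<bullet> V = 0" if s: "s \<in> I" for s
      unfolding V[OF s, symmetric]
      by (simp add: U_def inner_add_left inner_add_right inner_diff_right frame_inner s)
  qed
qed

end

theorem theorem2p1:
  fixes I :: "real set" and \<alpha> :: "real \<Rightarrow> real ^ 3"
  assumes "open I" and "is_interval I"
    and "arclength_parametrized_on I \<alpha>"
    and "\<And>s. s \<in> I \<Longrightarrow> curvature \<alpha> s > 0"
    and "\<not> contained_in_plane (\<alpha> ` I)"
  shows "normal_helix_orthogonal_axis_on I \<alpha> \<longleftrightarrow>
    (\<exists>\<theta>::real. \<theta> \<in> {- (pi / 2)<..<pi / 2} \<and>
       (\<forall>s\<in>I. curvature \<alpha> s / ((cos \<theta>)\<^sup>2 * (curvature \<alpha> s)\<^sup>2 + (torsion \<alpha> s)\<^sup>2) *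
          deriv (\<lambda>u. torsion \<alpha> u / curvature \<alpha> u) s = - tan \<theta>))"
proof -
  interpret frenet_curve I \<alpha>
    using assms(1-4) by unfold_locales
  let ?q' = "deriv (\<lambda>u. \<tau> u / \<kappa> u)"
  have nonempty: "I \<noteq> {}"
    using torsion_zero_imp_planar assms(5) by blast
  have equation_iff: "\<kappa> s / ((cos \<theta>)\<^sup>2 * (\<kappa> s)\<^sup>2 + (\<tau> s)\<^sup>2) * ?q' s = - tan \<theta> \<longleftrightarrow>
      ?q' s = - tan \<theta> * ((cos \<theta>)\<^sup>2 * \<kappa> s + (\<tau> s)\<^sup>2 / \<kappa> s)"
    if s: "s \<in> I" and \<theta>: "\<theta> \<in> {- (pi / 2)<..<pi / 2}" for s \<theta>
  proof -
    have pos: "(cos \<theta>)\<^sup>2 * (\<kappa> s)\<^sup>2 + (\<tau> s)\<^sup>2 > 0"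
      using cos_gt_zero_pi[of \<theta>] \<theta> curvature_pos[OF s] by (simp add: add_pos_nonneg)
    have factor: "(cos \<theta>)\<^sup>2 * \<kappa> s + (\<tau> s)\<^sup>2 / \<kappa> s =
        ((cos \<theta>)\<^sup>2 * (\<kappa> s)\<^sup>2 + (\<tau> s)\<^sup>2) / \<kappa> s"
      using curvature_pos[OF s] by (simp add: field_simps power2_eq_square)
    show ?thesis
      unfolding factor using pos curvature_pos[OF s] by (auto simp: field_simps)
  qed
  show ?thesis
  proof
    assume "normal_helix_orthogonal_axis_on I \<alpha>"
    then obtain W V where W: "F_constant_on I \<alpha> W" "normal_field_on I \<alpha> W"
      and unit: "\<And>s. s \<in> I \<Longrightarrow> norm (W s) = 1"
      and V: "V \<noteq> 0" and orth: "\<And>s. s \<in> I \<Longrightarrow> W s \<bullet> V = 0"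
      unfolding normal_helix_orthogonal_axis_on_def by blast
    obtain b c where W_eq: "\<And>s. s \<in> I \<Longrightarrow> W s = b *\<^sub>R N s + c *\<^sub>R B s"
      using F_constant_normal_field_coordinates[OF W] by blast
    have bc: "b\<^sup>2 + c\<^sup>2 = 1"
      using nonempty unit W_eq norm_unit_normal_combination by (metis all_not_in_conv)
    have orth': "(b *\<^sub>R N s + c *\<^sub>R B s) \<bullet> V = 0" if "s \<in> I" for s
      using orth W_eq that by metis
    have b: "b \<noteq> 0"
    proof
      assume "b = 0"
      then have "B s \<bullet> V = 0" if "s \<in> I" for s
        using orth'[OF that] bc by auto
      then show False
        using binormal_field_imp_torsion_zero V torsion_zero_imp_planar assms(5) by blast
    qed
    \<comment> \<open>The equation involves only \<open>c/b\<close> and \<open>b\<^sup>2 = 1/(1 + (c/b)\<^sup>2)\<close>, which are the same for \<open>W\<close>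
      and \<open>-W\<close>; reading \<open>\<theta>\<close> off from \<open>c/b\<close> covers both signs of \<open>b\<close> at once.\<close>
    define \<theta> where "\<theta> = arctan (c / b)"
    have \<theta>: "\<theta> \<in> {- (pi / 2)<..<pi / 2}" "tan \<theta> = c / b"
      using arctan_bounded[of "c / b"] by (auto simp: \<theta>_def tan_arctan)
    have "(cos \<theta>)\<^sup>2 = 1 / (1 + (c / b)\<^sup>2)"
      by (simp add: \<theta>_def cos_arctan power_divide add_nonneg_nonneg)
    also have "1 + (c / b)\<^sup>2 = 1 / b\<^sup>2"
      using bc b by (simp add: field_simps)
    finally have cos: "(cos \<theta>)\<^sup>2 = b\<^sup>2"
      by simp
    show "\<exists>\<theta>. \<theta> \<in> {- (pi / 2)<..<pi / 2} \<and>
        (\<forall>s\<in>I. \<kappa> s / ((cos \<theta>)\<^sup>2 * (\<kappa> s)\<^sup>2 + (\<tau> s)\<^sup>2) * ?q' s = - tan \<theta>)"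
    proof (intro exI[of _ \<theta>] conjI ballI \<theta>(1))
      fix s assume s: "s \<in> I"
      show "\<kappa> s / ((cos \<theta>)\<^sup>2 * (\<kappa> s)\<^sup>2 + (\<tau> s)\<^sup>2) * ?q' s = - tan \<theta>"
        unfolding equation_iff[OF s \<theta>(1)] unfolding cos \<theta>(2)
        by (rule axis_imp_ratio_equation[OF orth' bc b V s])
    qed
  next
    assume "\<exists>\<theta>. \<theta> \<in> {- (pi / 2)<..<pi / 2} \<and>
        (\<forall>s\<in>I. \<kappa> s / ((cos \<theta>)\<^sup>2 * (\<kappa> s)\<^sup>2 + (\<tau> s)\<^sup>2) * ?q' s = - tan \<theta>)"
    then obtain \<theta> where \<theta>: "\<theta> \<in> {- (pi / 2)<..<pi / 2}"
      and eq: "\<And>s. s \<in> I \<Longrightarrow> \<kappa> s / ((cos \<theta>)\<^sup>2 * (\<kappa> s)\<^sup>2 + (\<tau> s)\<^sup>2) * ?q' s = - tan \<theta>"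
      by blast
    have cs: "(cos \<theta>)\<^sup>2 + (sin \<theta>)\<^sup>2 = 1" "cos \<theta> \<noteq> 0"
      using cos_gt_zero_pi[of \<theta>] \<theta> by auto
    have "?q' s = - (sin \<theta> / cos \<theta>) * ((cos \<theta>)\<^sup>2 * \<kappa> s + (\<tau> s)\<^sup>2 / \<kappa> s)" if "s \<in> I" for s
      using equation_iff[OF that \<theta>] eq[OF that] by (simp add: tan_def)
    from ratio_equation_imp_axis[OF this cs nonempty]
    obtain V where V: "V \<noteq> 0" "\<And>s. s \<in> I \<Longrightarrow> (cos \<theta> *\<^sub>R N s + sin \<theta> *\<^sub>R B s) \<bullet> V = 0"
      by blast
    let ?W = "\<lambda>s. cos \<theta> *\<^sub>R N s + sin \<theta> *\<^sub>R B s"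
    have "normal_field_on I \<alpha> ?W"
      unfolding normal_field_on_def by (intro ballI span_add span_scale span_base) auto
    moreover have "\<forall>s\<in>I. norm (?W s) = 1"
      using norm_unit_normal_combination cs(1) by blast
    ultimately show "normal_helix_orthogonal_axis_on I \<alpha>"
      unfolding normal_helix_orthogonal_axis_on_def
      using constant_coordinates_F_constant V by blast
  qed
qed

end
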